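(* Let $d\ge 1$, $\sigma>0$, and let $\mu$ be the isotropic Gaussian distribution $\mathcal N(0,\sigma^2 I)$ on $\mathbb R^d$. Then every $g\in\mathcal G^{\mu}_{\mathcal F}$ is a real analytic function with infinite radius of convergence: for every point $w\in\mathbb R^d$, the Taylor series of $g$ around $w$ converges to $g$ everywhere, i.e. $g(x)=\sum_{\alpha\in\mathbb N^d}\frac{(x-w)^\alpha}{\alpha!}D^\alpha g(w)$ for all $x\in\mathbb R^d$.
   Context: $\mathcal Y$ is a finite set of classes, $\Delta^{\mathcal Y}$ the probability simplex of probability vectors indexed by $\mathcal Y$, and $\mathcal F$ the set of all (measurable) classifiers $f:\mathbb R^d\to\Delta^{\mathcal Y}$. For a probability density $\mu$ on $\mathbb R^d$, the smoothed classifier is $(f\star\mu)(x)=\int_{\mathbb R^d}f(x+z)\mu(z)\,dz$, and $\mathcal G^{\mu}_{\mathcal F}=\{f\star\mu: f\in\mathcal F\}$. Distributions are identified with their densities. Statements about vector-valued functions are componentwise. $\alpha\in\mathbb N^d$ is a multi-index ($0\in\mathbb N$), $\alpha!=\prod_i\alpha_i!$, $u^\alpha=\prod_i u_i^{\alpha_i}$, $D^\alpha$ the corresponding partial derivative. *)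

theory Defs
  imports "HOL-Probability.Probability"
begin

definition prob_simplex :: "(real ^ 'y::finite) set" where
  "prob_simplex = {p. (\<forall>y. 0 \<le> p $ y) \<and> (\<Sum>y\<in>UNIV. p $ y) = 1}"

text \<open>
  The index type \<open>'d\<close> plays the role of the coordinates of the input space (its cardinality is
  the dimension, which is automatically at least 1), and the finite type \<open>'y\<close> is the set of classes.
\<close>

definition classifiers :: "(real ^ 'd::finite \<Rightarrow> real ^ 'y::finite) set" where
  "classifiers = {f \<in> borel_measurable borel. \<forall>x. f x \<in> prob_simplex}"

definition smoothed ::
  "(real ^ 'd::finite \<Rightarrow> real ^ 'y::finite) \<Rightarrow> (real ^ 'd \<Rightarrow> real) \<Rightarrow> real ^ 'd \<Rightarrow> real ^ 'y" where
  "smoothed f \<mu> x = (\<integral>z. \<mu> z *\<^sub>R f (x + z) \<partial>lborel)"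

definition smoothed_class ::
  "(real ^ 'd::finite \<Rightarrow> real ^ 'y::finite) set \<Rightarrow> (real ^ 'd \<Rightarrow> real)
    \<Rightarrow> (real ^ 'd \<Rightarrow> real ^ 'y) set" where
  "smoothed_class F \<mu> = {smoothed f \<mu> | f. f \<in> F}"

definition gaussian_density :: "real \<Rightarrow> real ^ 'd::finite \<Rightarrow> real" where
  "gaussian_density \<sigma> z =
     exp (- (norm z)\<^sup>2 / (2 * \<sigma>\<^sup>2)) / sqrt (2 * pi * \<sigma>\<^sup>2) ^ CARD('d)"

lemma gaussian_density_eq_prod:
  "gaussian_density \<sigma> z = (\<Prod>i\<in>UNIV. normal_density 0 \<sigma> (z $ i))"
proof -
  have "(norm z)\<^sup>2 = (\<Sum>i\<in>UNIV. (z $ i)\<^sup>2)"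
    by (simp add: norm_vec_def L2_set_def sum_nonneg)
  then show ?thesis
    by (simp add: gaussian_density_def normal_density_def prod_dividef sum_divide_distrib
        flip: exp_sum sum_negf)
qed

definition partial_deriv ::
  "'d::finite \<Rightarrow> (real ^ 'd \<Rightarrow> 'b::real_normed_vector) \<Rightarrow> real ^ 'd \<Rightarrow> 'b" where
  "partial_deriv i g x = vector_derivative (\<lambda>t. g (x + t *\<^sub>R axis i 1)) (at 0)"

definition iter_partial_deriv ::
  "'d::finite list \<Rightarrow> (real ^ 'd \<Rightarrow> 'b::real_normed_vector) \<Rightarrow> real ^ 'd \<Rightarrow> 'b" where
  "iter_partial_deriv is g = foldr partial_deriv is g"

text \<open>
  Since \<^const>\<open>vector_derivative\<close> is total, differentiability has to be required explicitly:
  \<open>smooth\<close> says that all iterated partial derivatives exist everywhere and are continuous.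
\<close>

definition smooth :: "(real ^ 'd::finite \<Rightarrow> 'b::real_normed_vector) \<Rightarrow> bool" where
  "smooth g \<longleftrightarrow>
     (\<forall>is. continuous_on UNIV (iter_partial_deriv is g) \<and>
        (\<forall>i x. (\<lambda>t. iter_partial_deriv is g (x + t *\<^sub>R axis i 1)) differentiable (at 0)))"

text \<open>
  In the multi-index derivative, coordinate \<open>i\<close> is differentiated \<open>\<alpha> i\<close> times. The coordinate type
  carries no canonical order, so some order of differentiation is chosen; for smooth functions
  the result does not depend on it, by Schwarz's theorem.
\<close>

definition multi_deriv ::
  "('d::finite \<Rightarrow> nat) \<Rightarrow> (real ^ 'd \<Rightarrow> 'b::real_normed_vector) \<Rightarrow> real ^ 'd \<Rightarrow> 'b" where
  "multi_deriv \<alpha> g = iter_partial_deriv (SOME is. \<forall>i. count_list is i = \<alpha> i) g"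

lemma ex_list_of_multi_index:
  fixes \<alpha> :: "'d::finite \<Rightarrow> nat"
  shows "\<exists>is. \<forall>i. count_list is i = \<alpha> i"
proof -
  have "finite {i. 0 < \<alpha> i}" by simp
  then have "count (Abs_multiset \<alpha>) = \<alpha>"
    by (simp add: Abs_multiset_inverse)
  moreover obtain xs where "mset xs = Abs_multiset \<alpha>"
    using ex_mset by blast
  ultimately show ?thesis
    by (metis count_mset)
qed

definition multi_fact :: "('d::finite \<Rightarrow> nat) \<Rightarrow> real" where
  "multi_fact \<alpha> = (\<Prod>i\<in>UNIV. fact (\<alpha> i))"

definition multi_power :: "real ^ 'd::finite \<Rightarrow> ('d \<Rightarrow> nat) \<Rightarrow> real" where
  "multi_power u \<alpha> = (\<Prod>i\<in>UNIV. (u $ i) ^ \<alpha> i)"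

text \<open>
  Real analytic with infinite radius of convergence. The multi-indices are not ordered, so the
  Taylor series is summed unconditionally.
\<close>

definition real_analytic_infinite_radius ::
  "(real ^ 'd::finite \<Rightarrow> 'b::real_normed_vector) \<Rightarrow> bool" where
  "real_analytic_infinite_radius g \<longleftrightarrow>
     smooth g \<and>
     (\<forall>w x. ((\<lambda>\<alpha>. (multi_power (x - w) \<alpha> / multi_fact \<alpha>) *\<^sub>R multi_deriv \<alpha> g w)
              has_sum g x) UNIV)"

end

theory Submission
  imports Defs
begin

text \<open>
  After the substitution \<open>u = h + z\<close> the smoothed function at \<open>w + h\<close> is the integral of
  \<open>f (w + u)\<close> against the Gaussian translated by \<open>h\<close>. The translated Gaussian is the original one
  times a product of factors \<open>exp (u h / \<sigma>\<^sup>2 - h\<^sup>2 / (2 \<sigma>\<^sup>2))\<close>, each of which is an entire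
  function of \<open>h\<close>. Even with absolute values inside, the resulting multi-index series is bounded
  by a multiple of the Gaussian of standard deviation \<open>sqrt 2 * \<sigma>\<close>, so it may be integrated
  termwise against the bounded \<open>f\<close>. This gives an everywhere convergent power series around \<open>w\<close>,
  which can be differentiated termwise, so that its coefficients are the Taylor coefficients.
\<close>

section \<open>Termwise differentiation and integration of countable unordered sums\<close>

text \<open>Enumerating the index type turns the unordered sum into a sequential series. The
  majorant \<open>M\<close> makes the series of derivatives converge uniformly on \<open>S\<close>
  by the Weierstrass test, so the series may be differentiated termwise.\<close>

lemma infsum_has_vector_derivative:
  fixes f :: "'i \<Rightarrow> real \<Rightarrow> 'b::banach"
  assumes "countable (UNIV :: 'i set)" "infinite (UNIV :: 'i set)"
    and S: "convex S" "open S" "t \<in> S"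
    and deriv: "\<And>i s. s \<in> S \<Longrightarrow> (f i has_vector_derivative f' i s) (at s)"
    and bound: "\<And>i s. s \<in> S \<Longrightarrow> norm (f' i s) \<le> M i"
    and M: "M summable_on UNIV"
    and f: "\<And>s. s \<in> S \<Longrightarrow> (\<lambda>i. f i s) summable_on UNIV"
  shows "((\<lambda>s. \<Sum>\<^sub>\<infinity>i. f i s) has_vector_derivative (\<Sum>\<^sub>\<infinity>i. f' i t)) (at t)"
proof -
  define e where "e = from_nat_into (UNIV :: 'i set)"
  have e: "bij_betw e UNIV UNIV"
    unfolding e_def using assms(1,2) by (rule bij_betw_from_nat_into)
  have sums_f: "(\<lambda>n. f (e n) s) sums (\<Sum>\<^sub>\<infinity>i. f i s)" if "s \<in> S" for s
    using f[OF that] has_sum_reindex_bij_betw[OF e, of "\<lambda>i. f i s"]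
    by (intro has_sum_imp_sums) simp
  have M': "(\<lambda>n. M (e n)) summable_on UNIV"
    using M summable_on_reindex_bij_betw[OF e, of M] by simp
  have M0: "0 \<le> M i" for i
    using bound[OF S(3), of i] norm_ge_zero order_trans by blast
  have sums_f': "(\<lambda>n. f' (e n) s) sums (\<Sum>\<^sub>\<infinity>i. f' i s)" if "s \<in> S" for s
  proof -
    have "(\<lambda>i. norm (f' i s)) summable_on UNIV"
      using M bound[OF that] by (rule Infinite_Sum.abs_summable_on_comparison_test')
    then have "(\<lambda>i. f' i s) summable_on UNIV" by (rule Infinite_Sum.abs_summable_summable)
    then show ?thesis
      using has_sum_reindex_bij_betw[OF e, of "\<lambda>i. f' i s"]
      by (intro has_sum_imp_sums) simp
  qed
  have "uniform_limit S (\<lambda>n s. \<Sum>i<n. f' (e i) s) (\<lambda>s. \<Sum>i. f' (e i) s) sequentially"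
    using bound M' by (intro Weierstrass_m_test[where M = "\<lambda>n. M (e n)"])
      (auto intro: summable_on_imp_summable)
  then have unif: "\<forall>\<^sub>F n in sequentially. \<forall>s\<in>S. norm ((\<Sum>i<n. f' (e i) s) - (\<Sum>\<^sub>\<infinity>i. f' i s)) < \<epsilon>"
    if "\<epsilon> > 0" for \<epsilon>
    using that sums_f'[THEN sums_unique] by (auto simp: uniform_limit_iff dist_norm)
  have "\<exists>g. \<forall>x\<in>S. (\<lambda>n. f (e n) x) sums (g x)
      \<and> (g has_derivative (\<lambda>h. h *\<^sub>R (\<Sum>\<^sub>\<infinity>i. f' i x))) (at x within S)"
  proof (rule has_derivative_series[where f' = "\<lambda>n x h. h *\<^sub>R f' (e n) x"])
    show "(f (e n) has_derivative (\<lambda>h. h *\<^sub>R f' (e n) x)) (at x within S)" if "x \<in> S" for n x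
      using deriv[OF that] has_derivative_at_withinI unfolding has_vector_derivative_def by blast
    show "\<forall>\<^sub>F n in sequentially. \<forall>x\<in>S. \<forall>h.
        norm ((\<Sum>i<n. h *\<^sub>R f' (e i) x) - h *\<^sub>R (\<Sum>\<^sub>\<infinity>i. f' i x)) \<le> \<epsilon> * norm h" if "\<epsilon> > 0" for \<epsilon>
      using unif[OF that]
    proof eventually_elim
      case (elim n)
      show ?case
      proof (intro ballI allI)
        fix x :: real and h :: real assume "x \<in> S"
        then have "norm ((\<Sum>i<n. f' (e i) x) - (\<Sum>\<^sub>\<infinity>i. f' i x)) \<le> \<epsilon>"
          using elim by fastforce
        then show "norm ((\<Sum>i<n. h *\<^sub>R f' (e i) x) - h *\<^sub>R (\<Sum>\<^sub>\<infinity>i. f' i x)) \<le> \<epsilon> * norm h"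
          by (simp add: mult.commute[of \<epsilon>] mult_left_mono flip: scaleR_sum_right scaleR_diff_right)
      qed
    qed
  qed (use S sums_f in auto)
  then obtain g where g: "\<And>x. x \<in> S \<Longrightarrow> (\<lambda>n. f (e n) x) sums (g x)"
    "\<And>x. x \<in> S \<Longrightarrow> (g has_vector_derivative (\<Sum>\<^sub>\<infinity>i. f' i x)) (at x within S)"
    unfolding has_vector_derivative_def by blast
  have "(g has_vector_derivative (\<Sum>\<^sub>\<infinity>i. f' i t)) (at t)"
    using g(2)[OF S(3)] S at_within_open by metis
  moreover have "g x = (\<Sum>\<^sub>\<infinity>i. f i x)" if "x \<in> S" for x
    using g(1)[OF that] sums_f[OF that] sums_unique2 by blast
  ultimately show ?thesis
    by (rule has_vector_derivative_transform_within_open[OF _ S(2,3)])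
qed

text \<open>Dominated convergence for unordered sums: the one integrable \<open>G\<close> above all
  finite sums of norms controls both the pointwise series and the series of integrals of
  norms.\<close>

lemma has_sum_integral:
  fixes F :: "'i \<Rightarrow> 'a \<Rightarrow> 'b::{banach, second_countable_topology}"
  assumes "countable (UNIV :: 'i set)" "infinite (UNIV :: 'i set)"
    and meas: "\<And>i. F i \<in> borel_measurable M"
    and G: "integrable M G"
    and bound: "\<And>A x. finite A \<Longrightarrow> (\<Sum>i\<in>A. norm (F i x)) \<le> G x"
    and lim: "\<And>x. ((\<lambda>i. F i x) has_sum S x) UNIV"
  shows "((\<lambda>i. \<integral>x. F i x \<partial>M) has_sum (\<integral>x. S x \<partial>M)) UNIV"
proof -
  define e where "e = from_nat_into (UNIV :: 'i set)"
  have e: "bij_betw e UNIV UNIV"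
    unfolding e_def using assms(1,2) by (rule bij_betw_from_nat_into)
  have int: "integrable M (F i)" for i
  proof (rule Bochner_Integration.integrable_bound[OF G meas])
    show "AE x in M. norm (F i x) \<le> norm (G x)"
      using bound[of "{i}"] by (intro AE_I2) (auto intro: order_trans[OF _ abs_ge_self])
  qed
  have e_sum: "(\<Sum>i<n. norm (F (e i) x)) \<le> G x" for n x
  proof -
    have "(\<Sum>i<n. norm (F (e i) x)) = (\<Sum>i\<in>e ` {..<n}. norm (F i x))"
      using e by (subst sum.reindex) (auto simp: bij_betw_def intro: inj_on_subset)
    also have "\<dots> \<le> G x" by (intro bound) auto
    finally show ?thesis .
  qed
  have summable: "summable (\<lambda>n. norm (F (e n) x))" for x
    using e_sum by (intro summableI_nonneg_bounded) auto
  have summable_int: "summable (\<lambda>n. \<integral>x. norm (F (e n) x) \<partial>M)"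
  proof (rule summableI_nonneg_bounded)
    fix n
    have "(\<Sum>i<n. \<integral>x. norm (F (e i) x) \<partial>M) = (\<integral>x. (\<Sum>i<n. norm (F (e i) x)) \<partial>M)"
      using int by (subst Bochner_Integration.integral_sum) auto
    also have "\<dots> \<le> (\<integral>x. G x \<partial>M)"
      using int e_sum G by (intro integral_mono) auto
    finally show "(\<Sum>i<n. \<integral>x. norm (F (e i) x) \<partial>M) \<le> (\<integral>x. G x \<partial>M)" .
  qed (simp add: integral_nonneg_AE)
  have "(\<lambda>n. \<integral>x. F (e n) x \<partial>M) sums (\<integral>x. (\<Sum>n. F (e n) x) \<partial>M)"
    using int summable summable_int by (intro sums_integral) auto
  moreover have "(\<Sum>n. F (e n) x) = S x" for x
    using lim[of x] has_sum_reindex_bij_betw[OF e, of "\<lambda>i. F i x"] has_sum_imp_sums sums_unique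
    by (metis (no_types, lifting))
  ultimately have "(\<lambda>n. \<integral>x. F (e n) x \<partial>M) sums (\<integral>x. S x \<partial>M)" by simp
  \<comment> \<open>Absolute convergence makes the sum independent of the enumeration
    \<open>e\<close>, which leads from \<open>sums\<close> back to \<open>has_sum\<close>.\<close>
  moreover have "summable (\<lambda>n. norm (\<integral>x. F (e n) x \<partial>M))"
    using summable_int by (rule summable_comparison_test'[where N = 0]) (simp add: integral_norm_bound)
  ultimately have "((\<lambda>n. \<integral>x. F (e n) x \<partial>M) has_sum (\<integral>x. S x \<partial>M)) UNIV"
    by (intro norm_summable_imp_has_sum)
  then show ?thesis
    using has_sum_reindex_bij_betw[OF e, of "\<lambda>i. \<integral>x. F i x \<partial>M"] by simp
qed

text \<open>Enumerating the multi-indices bijectively by all of \<open>nat\<close> requires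
  infinitely many of them; the constant functions suffice.\<close>

lemma infinite_UNIV_multi_index: "infinite (UNIV :: ('d \<Rightarrow> nat) set)"
proof -
  have "inj (\<lambda>n::nat. (\<lambda>_::'d. n))" by (auto simp: inj_def fun_eq_iff)
  then show ?thesis
    by (metis finite_imageD finite_subset infinite_UNIV_nat subset_UNIV)
qed

section \<open>Everywhere convergent multivariate power series\<close>

text \<open>The power \<open>r ^ sum \<alpha> UNIV\<close> is the maximum of
  \<open>\<bar>multi_power h \<alpha>\<bar>\<close> over the cube of all \<open>h\<close> with
  coordinates at most \<open>r\<close> in absolute value. The condition is thus absolute
  convergence, uniform on every cube.\<close>

definition entire_coeffs :: "(('d::finite \<Rightarrow> nat) \<Rightarrow> 'b::real_normed_vector) \<Rightarrow> bool" where
  "entire_coeffs a \<longleftrightarrow> (\<forall>r\<ge>0. (\<lambda>\<alpha>. r ^ sum \<alpha> UNIV * norm (a \<alpha>)) summable_on UNIV)"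

definition multi_series :: "(('d::finite \<Rightarrow> nat) \<Rightarrow> 'b::real_normed_vector) \<Rightarrow> real ^ 'd \<Rightarrow> 'b" where
  "multi_series a h = (\<Sum>\<^sub>\<infinity>\<alpha>. multi_power h \<alpha> *\<^sub>R a \<alpha>)"

text \<open>The coefficients of the formal partial derivative of \<open>multi_series a\<close> in
  direction \<open>i\<close>, shifted so that they again belong to the monomials
  \<open>multi_power h \<alpha>\<close>.\<close>

definition partial_coeffs ::
  "'d::finite \<Rightarrow> (('d \<Rightarrow> nat) \<Rightarrow> 'b::real_normed_vector) \<Rightarrow> ('d \<Rightarrow> nat) \<Rightarrow> 'b" where
  "partial_coeffs i a \<alpha> = real (Suc (\<alpha> i)) *\<^sub>R a (\<alpha>(i := Suc (\<alpha> i)))"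

lemma abs_multi_power_le:
  assumes "\<And>i. \<bar>h $ i\<bar> \<le> r"
  shows "\<bar>multi_power h \<alpha>\<bar> \<le> r ^ sum \<alpha> UNIV"
  unfolding multi_power_def abs_prod power_sum power_abs
  using assms by (intro prod_mono) (auto simp: power_abs intro: power_mono)

lemma abs_multi_power_le_norm: "\<bar>multi_power h \<alpha>\<bar> \<le> norm h ^ sum \<alpha> UNIV"
  by (rule abs_multi_power_le) (rule component_le_norm_cart)

lemma sum_fun_upd_Suc: "sum (\<alpha>(i := Suc (\<alpha> i))) UNIV = Suc (sum \<alpha> (UNIV :: 'd::finite set))"
proof -
  have "sum (\<alpha>(i := Suc (\<alpha> i))) UNIV = (\<Sum>j\<in>UNIV. \<alpha> j + (if j = i then 1 else 0))"
    by (intro sum.cong) auto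
  then show ?thesis by (simp add: sum.distrib)
qed

lemma inj_fun_upd_Suc: "inj (\<lambda>\<alpha> :: 'd \<Rightarrow> nat. \<alpha>(i := Suc (\<alpha> i)))"
proof (rule injI)
  fix \<alpha> \<beta> :: "'d \<Rightarrow> nat" assume *: "\<alpha>(i := Suc (\<alpha> i)) = \<beta>(i := Suc (\<beta> i))"
  show "\<alpha> = \<beta>"
  proof
    fix j show "\<alpha> j = \<beta> j" using fun_cong[OF *, of j] by (cases "j = i") auto
  qed
qed

text \<open>Lets the factor produced by differentiating a monomial be absorbed by enlarging the
  radius from \<open>r\<close> to \<open>r + 1\<close>.\<close>

lemma Suc_mult_power_le:
  fixes r :: real
  assumes "0 \<le> r"
  shows "real (Suc n) * r ^ n \<le> (r + 1) ^ Suc n"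
proof (induction n)
  case (Suc n)
  have "real (Suc (Suc n)) * r ^ Suc n = r * (real (Suc n) * r ^ n) + r ^ Suc n"
    by (simp add: algebra_simps)
  also have "\<dots> \<le> r * (r + 1) ^ Suc n + (r + 1) ^ Suc n"
    using assms Suc by (intro add_mono mult_left_mono power_mono) auto
  also have "\<dots> = (r + 1) ^ Suc (Suc n)" by (simp add: algebra_simps)
  finally show ?case .
qed (use assms in auto)

lemma entire_coeffs_summable:
  fixes a :: "('d::finite \<Rightarrow> nat) \<Rightarrow> 'b::banach"
  assumes "entire_coeffs a"
  shows "(\<lambda>\<alpha>. multi_power h \<alpha> *\<^sub>R a \<alpha>) summable_on UNIV"
proof (rule Infinite_Sum.abs_summable_summable)
  have "(\<lambda>\<alpha>. norm h ^ sum \<alpha> UNIV * norm (a \<alpha>)) summable_on UNIV"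
    using assms by (simp add: entire_coeffs_def)
  then show "(\<lambda>\<alpha>. norm (multi_power h \<alpha> *\<^sub>R a \<alpha>)) summable_on UNIV"
    by (rule Infinite_Sum.abs_summable_on_comparison_test') (simp add: abs_multi_power_le_norm mult_right_mono)
qed

text \<open>Raising the index is injective, so the shifted coefficients form a subfamily of the
  series of \<open>a\<close> at radius \<open>r + 1\<close>; the larger radius pays for the factor
  \<open>Suc (\<alpha> i)\<close>.\<close>

lemma entire_coeffs_partial_coeffs:
  assumes "entire_coeffs a"
  shows "entire_coeffs (partial_coeffs i a)"
  unfolding entire_coeffs_def
proof (intro allI impI)
  fix r :: real assume r: "r \<ge> 0"
  let ?u = "\<lambda>\<alpha>. \<alpha>(i := Suc (\<alpha> i))"
  have "(\<lambda>\<alpha>. (r + 1) ^ sum \<alpha> UNIV * norm (a \<alpha>)) summable_on range ?u"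
  proof (rule summable_on_subset_banach)
    show "(\<lambda>\<alpha>. (r + 1) ^ sum \<alpha> UNIV * norm (a \<alpha>)) summable_on UNIV"
      using assms r by (simp add: entire_coeffs_def)
  qed simp
  then have "((\<lambda>\<alpha>. (r + 1) ^ sum \<alpha> UNIV * norm (a \<alpha>)) \<circ> ?u) summable_on UNIV"
    by (subst summable_on_reindex[symmetric]) (rule inj_fun_upd_Suc)
  then have "(\<lambda>\<alpha>. norm (r ^ sum \<alpha> UNIV * norm (partial_coeffs i a \<alpha>))) summable_on UNIV"
  proof (rule Infinite_Sum.abs_summable_on_comparison_test')
    fix \<alpha>
    have "real (Suc (\<alpha> i)) * r ^ sum \<alpha> UNIV \<le> real (Suc (sum \<alpha> UNIV)) * r ^ sum \<alpha> UNIV"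
      using r by (intro mult_right_mono) (auto intro: member_le_sum)
    also have "\<dots> \<le> (r + 1) ^ Suc (sum \<alpha> UNIV)"
      using r by (rule Suc_mult_power_le)
    finally have "real (Suc (\<alpha> i)) * r ^ sum \<alpha> UNIV * norm (a (?u \<alpha>))
        \<le> (r + 1) ^ Suc (sum \<alpha> UNIV) * norm (a (?u \<alpha>))"
      by (rule mult_right_mono) simp
    then show "norm (r ^ sum \<alpha> UNIV * norm (partial_coeffs i a \<alpha>))
        \<le> ((\<lambda>\<alpha>. (r + 1) ^ sum \<alpha> UNIV * norm (a \<alpha>)) \<circ> ?u) \<alpha>"
      using r by (simp add: partial_coeffs_def sum_fun_upd_Suc abs_mult mult.left_commute mult.assoc
        del: fun_upd_apply of_nat_Suc power_Suc)
  qed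
  then show "(\<lambda>\<alpha>. r ^ sum \<alpha> UNIV * norm (partial_coeffs i a \<alpha>)) summable_on UNIV"
    using r by (simp add: abs_mult)
qed

lemma continuous_on_multi_series:
  fixes a :: "('d::finite \<Rightarrow> nat) \<Rightarrow> 'b::banach"
  assumes "entire_coeffs a"
  shows "continuous_on UNIV (multi_series a)"
proof -
  have "continuous_on (ball 0 r) (multi_series a)" if r: "r > 0" for r
  proof (rule uniform_limit_theorem)
    show "uniform_limit (ball 0 r) (\<lambda>X h. \<Sum>\<alpha>\<in>X. multi_power h \<alpha> *\<^sub>R a \<alpha>) (multi_series a)
        (finite_subsets_at_top UNIV)"
      unfolding multi_series_def
    proof (rule Weierstrass_m_test_general)
      show "(\<lambda>\<alpha>. r ^ sum \<alpha> UNIV * norm (a \<alpha>)) summable_on UNIV"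
        using assms r by (simp add: entire_coeffs_def)
      show "norm (multi_power h \<alpha> *\<^sub>R a \<alpha>) \<le> r ^ sum \<alpha> UNIV * norm (a \<alpha>)" if "h \<in> ball 0 r" for h \<alpha>
      proof -
        have "\<bar>h $ i\<bar> \<le> r" for i
          using that component_le_norm_cart[of h i] by simp
        then show ?thesis
          by (simp add: abs_multi_power_le mult_right_mono)
      qed
    qed
    show "\<forall>\<^sub>F X in finite_subsets_at_top UNIV.
        continuous_on (ball 0 r) (\<lambda>h. \<Sum>\<alpha>\<in>X. multi_power h \<alpha> *\<^sub>R a \<alpha>)"
      unfolding multi_power_def by (intro always_eventually allI continuous_intros)
  qed simp
  \<comment> \<open>The open ball of radius \<open>norm x + 1\<close> around the origin contains
    \<open>x\<close>.\<close>
  then have "isCont (multi_series a) x" for x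
    by (metis continuous_on_eq_continuous_at less_add_one norm_ge_zero mem_ball_0
        open_ball order.strict_trans1)
  then show ?thesis by (simp add: continuous_at_imp_continuous_on)
qed

text \<open>If \<open>\<alpha> i = 0\<close>, the truncated subtraction leaves the index unchanged,
  but the factor \<open>real (\<alpha> i)\<close> vanishes.\<close>

lemma multi_power_has_derivative:
  "((\<lambda>t. multi_power (h + t *\<^sub>R axis i 1) \<alpha>) has_real_derivative
    real (\<alpha> i) * multi_power (h + s *\<^sub>R axis i 1) (\<alpha>(i := \<alpha> i - 1))) (at s)"
proof -
  have split: "multi_power (h + t *\<^sub>R axis i 1) \<beta> = (h $ i + t) ^ \<beta> i * (\<Prod>j\<in>UNIV - {i}. h $ j ^ \<beta> j)"
    for t \<beta>
    unfolding multi_power_def by (subst prod.remove[of _ i]) (auto simp: axis_def intro!: prod.cong)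
  have *: "(\<Prod>j\<in>UNIV - {i}. h $ j ^ (\<alpha>(i := \<alpha> i - 1)) j) = (\<Prod>j\<in>UNIV - {i}. h $ j ^ \<alpha> j)"
    by (intro prod.cong) auto
  show ?thesis
    unfolding split * by (auto intro!: derivative_eq_intros)
qed

text \<open>Terms with \<open>\<alpha> i = 0\<close> vanish, and every other index arises from
  exactly one index by raising entry \<open>i\<close>, so the sum can be reindexed along that
  shift.\<close>

lemma infsum_partial_coeffs:
  fixes a :: "('d::finite \<Rightarrow> nat) \<Rightarrow> 'b::real_normed_vector"
  shows "(\<Sum>\<^sub>\<infinity>\<alpha>. (real (\<alpha> i) * multi_power h (\<alpha>(i := \<alpha> i - 1))) *\<^sub>R a \<alpha>) = multi_series (partial_coeffs i a) h"
    (is "infsum ?f UNIV = _")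
proof -
  let ?u = "\<lambda>\<alpha> :: 'd \<Rightarrow> nat. \<alpha>(i := Suc (\<alpha> i))"
  have "\<alpha> \<in> range ?u" if "\<alpha> i \<noteq> 0" for \<alpha>
    using that by (intro image_eqI[of _ _ "\<alpha>(i := \<alpha> i - 1)"]) auto
  then have "infsum ?f UNIV = infsum ?f (range ?u)"
    by (intro infsum_cong_neutral) force+
  also have "\<dots> = infsum (?f \<circ> ?u) UNIV"
    by (rule infsum_reindex) (rule inj_fun_upd_Suc)
  also have "\<dots> = multi_series (partial_coeffs i a) h"
    by (simp add: multi_series_def partial_coeffs_def o_def mult.commute)
  finally show ?thesis .
qed

lemma multi_series_has_vector_derivative:
  fixes a :: "('d::finite \<Rightarrow> nat) \<Rightarrow> 'b::banach"
  assumes "entire_coeffs a"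
  shows "((\<lambda>t. multi_series a (h + t *\<^sub>R axis i 1)) has_vector_derivative
    multi_series (partial_coeffs i a) h) (at 0)"
proof -
  \<comment> \<open>This bounds all coordinates of \<open>h + s *\<^sub>R axis i 1\<close> for
    \<open>s\<close> in \<open>ball 0 1\<close>. The majorant below uses radius
    \<open>r + 1\<close>, leaving room for the factor \<open>\<alpha> i\<close>.\<close>
  define r where "r = norm h + 1"
  have r: "r \<ge> 0" by (simp add: r_def add_nonneg_nonneg)
  have "((\<lambda>t. \<Sum>\<^sub>\<infinity>\<alpha>. multi_power (h + t *\<^sub>R axis i 1) \<alpha> *\<^sub>R a \<alpha>) has_vector_derivative
    (\<Sum>\<^sub>\<infinity>\<alpha>. (real (\<alpha> i) * multi_power (h + 0 *\<^sub>R axis i 1) (\<alpha>(i := \<alpha> i - 1))) *\<^sub>R a \<alpha>)) (at 0)"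
  proof (rule infsum_has_vector_derivative[where S = "ball 0 1"])
    show "(\<lambda>\<alpha>. (r + 1) ^ sum \<alpha> UNIV * norm (a \<alpha>)) summable_on UNIV"
      using assms r by (simp add: entire_coeffs_def)
    fix \<alpha> and s :: real assume "s \<in> ball 0 1"
    then have "norm (h + s *\<^sub>R axis i 1) \<le> r"
      using norm_triangle_ineq[of h "s *\<^sub>R axis i 1"] by (simp add: r_def)
    then have r': "\<bar>(h + s *\<^sub>R axis i 1) $ j\<bar> \<le> r" for j
      using component_le_norm_cart order_trans by blast
    show "norm ((real (\<alpha> i) * multi_power (h + s *\<^sub>R axis i 1) (\<alpha>(i := \<alpha> i - 1))) *\<^sub>R a \<alpha>)
        \<le> (r + 1) ^ sum \<alpha> UNIV * norm (a \<alpha>)"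
    proof (cases "\<alpha> i")
      case 0
      then show ?thesis using r by simp
    next
      case (Suc n)
      define \<beta> where "\<beta> = \<alpha>(i := n)"
      have \<alpha>: "\<alpha> = \<beta>(i := Suc (\<beta> i))" using Suc by (auto simp: \<beta>_def)
      have "real (Suc (\<beta> i)) * \<bar>multi_power (h + s *\<^sub>R axis i 1) \<beta>\<bar>
          \<le> real (Suc (sum \<beta> UNIV)) * r ^ sum \<beta> UNIV"
        using r r' by (intro mult_mono abs_multi_power_le) (auto intro: member_le_sum simp del: of_nat_Suc)
      also have "\<dots> \<le> (r + 1) ^ sum \<alpha> UNIV"
        unfolding \<alpha> sum_fun_upd_Suc using r by (rule Suc_mult_power_le)
      finally show ?thesis
        by (simp add: Suc \<beta>_def abs_mult mult_right_mono)
    qed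
  next
    fix \<alpha> and s :: real
    show "((\<lambda>t. multi_power (h + t *\<^sub>R axis i 1) \<alpha> *\<^sub>R a \<alpha>) has_vector_derivative
        (real (\<alpha> i) * multi_power (h + s *\<^sub>R axis i 1) (\<alpha>(i := \<alpha> i - 1))) *\<^sub>R a \<alpha>) (at s)"
      using multi_power_has_derivative[of h i \<alpha> s]
      by (auto intro!: derivative_eq_intros has_vector_derivative_scaleR)
  qed (use assms infinite_UNIV_multi_index in \<open>auto intro: entire_coeffs_summable\<close>)
  then show ?thesis
    unfolding infsum_partial_coeffs multi_series_def[symmetric] by simp
qed

lemma multi_series_0:
  fixes a :: "('d::finite \<Rightarrow> nat) \<Rightarrow> 'b::real_normed_vector"
  shows "multi_series a 0 = a (\<lambda>_. 0)"
proof -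
  have "multi_power (0 :: real ^ 'd) \<alpha> = 0" if "\<alpha> \<noteq> (\<lambda>_. 0)" for \<alpha> :: "'d \<Rightarrow> nat"
    using that by (auto simp: multi_power_def fun_eq_iff power_0_left)
  then have "multi_series a 0 = (\<Sum>\<^sub>\<infinity>\<alpha>\<in>{\<lambda>_. 0}. multi_power 0 \<alpha> *\<^sub>R a \<alpha>)"
    unfolding multi_series_def by (intro infsum_cong_neutral) auto
  then show ?thesis by (simp add: multi_power_def)
qed

lemma entire_coeffs_foldr: "entire_coeffs a \<Longrightarrow> entire_coeffs (foldr partial_coeffs is a)"
  by (induction "is") (auto intro: entire_coeffs_partial_coeffs)

text \<open>The preceding derivative at parameter 0 holds for every base point, so a partial
  derivative is again a power series around \<open>w\<close> as a function, and the next one can be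
  taken in the same way.\<close>

lemma iter_partial_deriv_multi_series:
  fixes a :: "('d::finite \<Rightarrow> nat) \<Rightarrow> 'b::banach"
  assumes "entire_coeffs a"
  shows "iter_partial_deriv is (\<lambda>x. multi_series a (x - w)) = (\<lambda>x. multi_series (foldr partial_coeffs is a) (x - w))"
proof (induction "is")
  case (Cons i "is")
  have "partial_deriv i (\<lambda>x. multi_series (foldr partial_coeffs is a) (x - w)) x =
      multi_series (foldr partial_coeffs (i # is) a) (x - w)" for x
    using multi_series_has_vector_derivative[OF entire_coeffs_foldr[OF assms], of "is" "x - w" i]
    by (auto simp: partial_deriv_def add_diff_eq diff_add_eq intro: vector_derivative_at)
  then show ?case using Cons by (simp add: iter_partial_deriv_def)
qed (simp add: iter_partial_deriv_def)

text \<open>Each differentiation in direction \<open>j\<close> contributes one factor of a rising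
  product, which collects to a quotient of factorials. The index \<beta> stays arbitrary because
  \<open>partial_coeffs\<close> evaluates its argument at a raised index.\<close>

lemma foldr_partial_coeffs:
  "foldr partial_coeffs is a \<beta> =
    (\<Prod>j\<in>UNIV. fact (\<beta> j + count_list is j) / fact (\<beta> j)) *\<^sub>R a (\<lambda>j. \<beta> j + count_list is j)"
proof (induction "is" arbitrary: \<beta>)
  case (Cons i "is")
  let ?\<beta> = "\<beta>(i := Suc (\<beta> i))"
  have "(\<lambda>j. ?\<beta> j + count_list is j) = (\<lambda>j. \<beta> j + count_list (i # is) j)"
    by auto
  moreover have "real (Suc (\<beta> i)) * (\<Prod>j\<in>UNIV. fact (?\<beta> j + count_list is j) / fact (?\<beta> j)) =
      (\<Prod>j\<in>UNIV. fact (\<beta> j + count_list (i # is) j) / fact (\<beta> j))"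
  proof -
    have "(\<Prod>j\<in>UNIV - {i}. fact (?\<beta> j + count_list is j) / fact (?\<beta> j) :: real) =
        (\<Prod>j\<in>UNIV - {i}. fact (\<beta> j + count_list (i # is) j) / fact (\<beta> j))"
      by (intro prod.cong) auto
    then show ?thesis
      by (subst (1 2) prod.remove[of _ i]) (auto simp: field_simps simp del: of_nat_Suc)
  qed
  ultimately show ?case
    by (simp only: foldr_Cons o_apply partial_coeffs_def[of i] Cons scaleR_scaleR)
qed simp

lemma multi_deriv_multi_series:
  fixes a :: "('d::finite \<Rightarrow> nat) \<Rightarrow> 'b::banach"
  assumes "entire_coeffs a"
  shows "multi_deriv \<alpha> (\<lambda>x. multi_series a (x - w)) w = multi_fact \<alpha> *\<^sub>R a \<alpha>"
proof -
  \<comment> \<open>Only the counts of the chosen list matter: \<open>foldr_partial_coeffs\<close>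
    depends on nothing else. At the center, only the coefficient with index 0 survives.\<close>
  define js where "js = (SOME is. \<forall>i. count_list is i = \<alpha> i)"
  have js: "count_list js i = \<alpha> i" for i
    using someI_ex[OF ex_list_of_multi_index[of \<alpha>]] unfolding js_def by blast
  show ?thesis
    unfolding multi_deriv_def iter_partial_deriv_multi_series[OF assms] js_def[symmetric]
    by (simp add: multi_series_0 foldr_partial_coeffs js multi_fact_def)
qed

lemma smooth_multi_series:
  fixes a :: "('d::finite \<Rightarrow> nat) \<Rightarrow> 'b::banach"
  assumes "entire_coeffs a"
  shows "smooth (\<lambda>x. multi_series a (x - w))"
  unfolding smooth_def iter_partial_deriv_multi_series[OF assms]
proof (intro allI conjI)
  fix "is" :: "'d list" and i x
  have a: "entire_coeffs (foldr partial_coeffs is a)"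
    using assms by (rule entire_coeffs_foldr)
  show "continuous_on UNIV (\<lambda>x. multi_series (foldr partial_coeffs is a) (x - w))"
    by (intro continuous_on_compose2[OF continuous_on_multi_series[OF a]] continuous_intros) auto
  show "(\<lambda>t. multi_series (foldr partial_coeffs is a) (x + t *\<^sub>R axis i 1 - w)) differentiable at 0"
    using multi_series_has_vector_derivative[OF a, of "x - w" i]
    by (auto simp: add_diff_eq diff_add_eq intro: differentiableI_vector)
qed

text \<open>Any everywhere convergent expansion around \<open>w\<close> is the Taylor series there,
  since \<open>multi_deriv_multi_series\<close> recovers its coefficients from the
  derivatives.\<close>

lemma real_analytic_infinite_radiusI:
  fixes g :: "real ^ 'd::finite \<Rightarrow> 'b::banach"
  assumes "\<And>w. \<exists>a. entire_coeffs a \<and> (\<forall>h. g (w + h) = multi_series a h)"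
  shows "real_analytic_infinite_radius g"
proof -
  have ex: "\<exists>a. entire_coeffs a \<and> g = (\<lambda>x. multi_series a (x - w))" for w
  proof -
    obtain a where "entire_coeffs a" "\<And>h. g (w + h) = multi_series a h"
      using assms by blast
    then show ?thesis by (metis add.commute diff_add_cancel)
  qed
  show ?thesis
    unfolding real_analytic_infinite_radius_def
  proof (intro conjI allI)
    show "smooth g" using ex smooth_multi_series by metis
    fix w x
    obtain a where a: "entire_coeffs a" and g: "g = (\<lambda>x. multi_series a (x - w))"
      using ex by blast
    have "multi_fact \<alpha> \<noteq> 0" for \<alpha> :: "'d \<Rightarrow> nat"
      by (simp add: multi_fact_def)
    then show "((\<lambda>\<alpha>. (multi_power (x - w) \<alpha> / multi_fact \<alpha>) *\<^sub>R multi_deriv \<alpha> g w) has_sum g x) UNIV"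
      using has_sum_infsum[OF entire_coeffs_summable[OF a, of "x - w"]]
      unfolding g multi_deriv_multi_series[OF a] multi_series_def[symmetric] by simp
  qed
qed

section \<open>The Taylor expansion of a translated Gaussian density\<close>

text \<open>
  The Taylor coefficients of \<open>h \<mapsto> exp (u * h + c * h\<^sup>2)\<close> at \<open>0\<close>, i.e. rescaled Hermite polynomials in \<open>u\<close>.
\<close>

definition gauss_coeff :: "real \<Rightarrow> real \<Rightarrow> nat \<Rightarrow> real" where
  "gauss_coeff u c n =
    (\<Sum>i\<le>n. u ^ i / fact i * (if even (n - i) then c ^ ((n - i) div 2) / fact ((n - i) div 2) else 0))"

lemma exp_square_sums:
  fixes c h :: real
  shows "(\<lambda>n. (if even n then c ^ (n div 2) / fact (n div 2) else 0) * h ^ n) sums exp (c * h\<^sup>2)"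
proof -
  have "(\<lambda>n. (c * h\<^sup>2) ^ n / fact n) sums exp (c * h\<^sup>2)"
    using exp_converges[of "c * h\<^sup>2"] by (simp add: divide_inverse mult.commute)
  \<comment> \<open>Interleaving with the zero series places the powers of \<open>h\<^sup>2\<close>
    at the even positions.\<close>
  from sums_if[OF sums_zero this]
  have "(\<lambda>n. if even n then (c * h\<^sup>2) ^ (n div 2) / fact (n div 2) else 0) sums exp (c * h\<^sup>2)"
    by simp
  also have "(\<lambda>n. if even n then (c * h\<^sup>2) ^ (n div 2) / fact (n div 2) else 0) =
      (\<lambda>n. (if even n then c ^ (n div 2) / fact (n div 2) else 0) * h ^ n)"
    by (auto simp: power_mult_distrib simp flip: power_mult elim!: evenE)
  finally show ?thesis .
qed

lemma exp_linear_sums: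
  fixes u h :: real
  shows "(\<lambda>n. u ^ n / fact n * h ^ n) sums exp (u * h)"
  using exp_converges[of "u * h"] by (simp add: power_mult_distrib field_simps)

text \<open>Cauchy product of the series of \<open>exp (u * h)\<close> and
  \<open>exp (c * h\<^sup>2)\<close>. Both converge absolutely because the norms of their terms form
  the same series at the absolute values of \<open>u\<close>, \<open>c\<close> and
  \<open>h\<close>.\<close>

lemma gauss_coeff_sums: "(\<lambda>n. gauss_coeff u c n * h ^ n) sums exp (u * h + c * h\<^sup>2)"
proof -
  let ?a = "\<lambda>n. u ^ n / fact n * h ^ n"
  let ?b = "\<lambda>n. (if even n then c ^ (n div 2) / fact (n div 2) else 0) * h ^ n"
  have a: "summable (\<lambda>n. norm (?a n))"
    using exp_linear_sums[of "\<bar>u\<bar>" "\<bar>h\<bar>"] by (simp add: abs_mult power_abs sums_iff)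
  have b: "(\<lambda>n. norm (?b n)) =
      (\<lambda>n. (if even n then \<bar>c\<bar> ^ (n div 2) / fact (n div 2) else 0) * \<bar>h\<bar> ^ n)"
    by (auto simp: abs_mult power_abs)
  have "summable (\<lambda>n. norm (?b n))"
    unfolding b by (rule sums_summable[OF exp_square_sums])
  with a have "(\<lambda>n. \<Sum>i\<le>n. ?a i * ?b (n - i)) sums ((\<Sum>n. ?a n) * (\<Sum>n. ?b n))"
    by (rule Cauchy_product_sums)
  also have "(\<Sum>n. ?a n) = exp (u * h)"
    using exp_linear_sums by (rule sums_unique[symmetric])
  also have "(\<Sum>n. ?b n) = exp (c * h\<^sup>2)"
    using exp_square_sums by (rule sums_unique[symmetric])
  also have "(\<lambda>n. \<Sum>i\<le>n. ?a i * ?b (n - i)) = (\<lambda>n. gauss_coeff u c n * h ^ n)"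
  proof
    fix n
    have "?a i * ?b (n - i) = u ^ i / fact i *
        (if even (n - i) then c ^ ((n - i) div 2) / fact ((n - i) div 2) else 0) * h ^ n" if "i \<le> n" for i
    proof -
      have "h ^ n = h ^ i * h ^ (n - i)" using that by (simp flip: power_add)
      then show ?thesis by simp
    qed
    then show "(\<Sum>i\<le>n. ?a i * ?b (n - i)) = gauss_coeff u c n * h ^ n"
      unfolding gauss_coeff_def sum_distrib_right by (intro sum.cong refl) (simp only: atMost_iff)
  qed
  finally show ?thesis by (simp add: exp_add)
qed

text \<open>As a polynomial in \<open>u\<close> and \<open>c\<close>, \<open>gauss_coeff\<close> has
  nonnegative coefficients.\<close>

lemma abs_gauss_coeff_le: "\<bar>gauss_coeff u c n\<bar> \<le> gauss_coeff \<bar>u\<bar> \<bar>c\<bar> n"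
  unfolding gauss_coeff_def
  by (rule order_trans[OF sum_abs]) (auto intro!: sum_mono simp: abs_mult power_abs)

text \<open>A finite set of multi-indices lies in a box, and the sum over a box factors into
  one-variable partial sums, each below its full exponential series. The bound does not depend on
  \<open>A\<close>, as dominated integration requires.\<close>

lemma sum_prod_gauss_coeff_le:
  fixes u :: "'d::finite \<Rightarrow> real"
  assumes "finite A" and r: "r \<ge> 0"
  shows "(\<Sum>\<alpha>\<in>A. r ^ sum \<alpha> UNIV * \<bar>\<Prod>i\<in>UNIV. gauss_coeff (u i) c (\<alpha> i)\<bar>)
    \<le> (\<Prod>i\<in>UNIV. exp (\<bar>u i\<bar> * r + \<bar>c\<bar> * r\<^sup>2))"
proof -
  let ?g = "\<lambda>i n. gauss_coeff \<bar>u i\<bar> \<bar>c\<bar> n * r ^ n"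
  \<comment> \<open>A crude common bound for all entries of all multi-indices in
    \<open>A\<close>.\<close>
  define N where "N = (\<Sum>\<alpha>\<in>A. sum \<alpha> UNIV)"
  have g0: "0 \<le> ?g i n" for i n
    using abs_gauss_coeff_le[of "u i" c n] r by (intro mult_nonneg_nonneg) auto
  have "\<alpha> i \<le> N" if "\<alpha> \<in> A" for \<alpha> i
  proof -
    have "\<alpha> i \<le> sum \<alpha> UNIV" by (rule member_le_sum) auto
    also have "\<dots> \<le> N" unfolding N_def using that assms(1) by (intro member_le_sum) auto
    finally show ?thesis .
  qed
  then have A: "A \<subseteq> Pi\<^sub>E UNIV (\<lambda>_. {..N})" by auto
  have "(\<Sum>\<alpha>\<in>A. r ^ sum \<alpha> UNIV * \<bar>\<Prod>i\<in>UNIV. gauss_coeff (u i) c (\<alpha> i)\<bar>)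
      \<le> (\<Sum>\<alpha>\<in>A. \<Prod>i\<in>UNIV. ?g i (\<alpha> i))"
    unfolding abs_prod power_sum prod.distrib[symmetric] using r
    by (intro sum_mono prod_mono) (auto simp: mult.commute[of "r ^ _"] intro!: mult_right_mono abs_gauss_coeff_le)
  also have "\<dots> \<le> (\<Sum>\<alpha>\<in>Pi\<^sub>E UNIV (\<lambda>_. {..N}). \<Prod>i\<in>UNIV. ?g i (\<alpha> i))"
    using A g0 by (intro sum_mono2 prod_nonneg finite_PiE) auto
  also have "\<dots> = (\<Prod>i\<in>UNIV. \<Sum>n\<le>N. ?g i n)"
    by (rule prod_sum_PiE[symmetric]) auto
  also have "\<dots> \<le> (\<Prod>i\<in>UNIV. exp (\<bar>u i\<bar> * r + \<bar>c\<bar> * r\<^sup>2))"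
  proof (intro prod_mono conjI sum_nonneg g0)
    fix i
    have "(\<Sum>n\<le>N. ?g i n) \<le> (\<Sum>n. ?g i n)"
      using gauss_coeff_sums[of "\<bar>u i\<bar>" "\<bar>c\<bar>" r] g0
      by (intro sum_le_suminf) (auto simp: sums_iff)
    then show "(\<Sum>n\<le>N. ?g i n) \<le> exp (\<bar>u i\<bar> * r + \<bar>c\<bar> * r\<^sup>2)"
      using gauss_coeff_sums[of "\<bar>u i\<bar>" "\<bar>c\<bar>" r] by (simp add: sums_iff)
  qed
  finally show ?thesis .
qed

lemma prod_gauss_coeff_has_sum:
  fixes u :: "'d::finite \<Rightarrow> real" and h :: "real ^ 'd"
  shows "((\<lambda>\<alpha>. multi_power h \<alpha> * (\<Prod>i\<in>UNIV. gauss_coeff (u i) c (\<alpha> i))) has_sum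
    (\<Prod>i\<in>UNIV. exp (u i * h $ i + c * (h $ i)\<^sup>2))) UNIV"
proof -
  let ?f = "\<lambda>i n. gauss_coeff (u i) c n * h $ i ^ n"
  have abs: "(\<lambda>n. norm (?f i n)) summable_on UNIV" for i
  proof -
    have "summable (\<lambda>n. gauss_coeff \<bar>u i\<bar> \<bar>c\<bar> n * \<bar>h $ i\<bar> ^ n)"
      using gauss_coeff_sums by (rule sums_summable)
    then have "summable (\<lambda>n. norm (?f i n))"
      by (rule summable_comparison_test'[where N = 0])
        (auto simp: abs_mult power_abs intro: mult_right_mono abs_gauss_coeff_le)
    then show ?thesis by (simp add: summable_on_UNIV_nonneg_real_iff)
  qed
  have "(?f i has_sum exp (u i * h $ i + c * (h $ i)\<^sup>2)) UNIV" for i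
    using abs[of i] gauss_coeff_sums
    by (intro norm_summable_imp_has_sum) (auto simp: summable_on_UNIV_nonneg_real_iff)
  then have f: "infsum (?f i) UNIV = exp (u i * h $ i + c * (h $ i)\<^sup>2)" for i
    by (rule infsumI)
  have F: "(\<Prod>i\<in>UNIV. ?f i (\<alpha> i)) = multi_power h \<alpha> * (\<Prod>i\<in>UNIV. gauss_coeff (u i) c (\<alpha> i))" for \<alpha>
    by (simp add: prod.distrib multi_power_def mult.commute)
  have "infsum (\<lambda>\<alpha>. \<Prod>i\<in>UNIV. ?f i (\<alpha> i)) (Pi\<^sub>E UNIV (\<lambda>_. UNIV)) =
      (\<Prod>i\<in>UNIV. infsum (?f i) UNIV)"
    by (rule infsum_prod_PiE_abs) (use abs in auto)
  then have inf: "infsum (\<lambda>\<alpha>. \<Prod>i\<in>UNIV. ?f i (\<alpha> i)) UNIV =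
      (\<Prod>i\<in>UNIV. exp (u i * h $ i + c * (h $ i)\<^sup>2))"
    by (simp add: f PiE_UNIV_domain)
  \<comment> \<open>The value of \<open>infsum\<close> alone does not give \<open>has_sum\<close>,
    so summability is shown separately, from the uniform bound with
    \<open>r = norm h\<close>.\<close>
  have "(\<lambda>\<alpha>. norm (\<Prod>i\<in>UNIV. ?f i (\<alpha> i))) summable_on UNIV"
  proof (rule nonneg_bdd_above_summable_on)
    have "(\<Sum>\<alpha>\<in>A. norm (\<Prod>i\<in>UNIV. ?f i (\<alpha> i)))
        \<le> (\<Prod>i\<in>UNIV. exp (\<bar>u i\<bar> * norm h + \<bar>c\<bar> * (norm h)\<^sup>2))" if "finite A" for A
      unfolding F
      using that
      by (intro order_trans[OF sum_mono sum_prod_gauss_coeff_le])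
        (auto simp: abs_mult intro!: mult_right_mono abs_multi_power_le_norm)
    then show "bdd_above (sum (\<lambda>\<alpha>. norm (\<Prod>i\<in>UNIV. ?f i (\<alpha> i))) ` {F. F \<subseteq> UNIV \<and> finite F})"
      by (intro bdd_aboveI) auto
  qed simp
  then have "(\<lambda>\<alpha>. \<Prod>i\<in>UNIV. ?f i (\<alpha> i)) summable_on UNIV"
    by (rule Infinite_Sum.abs_summable_summable)
  from has_sum_infsum[OF this] show ?thesis
    unfolding inf unfolding F .
qed

text \<open>Expanding the square gives an exponent of the form \<open>u * h + c * h\<^sup>2\<close>,
  to which \<open>gauss_coeff_sums\<close> applies.\<close>

lemma normal_density_diff:
  "normal_density 0 \<sigma> (x - h) =
    normal_density 0 \<sigma> x * exp (x / \<sigma>\<^sup>2 * h + - 1 / (2 * \<sigma>\<^sup>2) * h\<^sup>2)"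
proof -
  have "- (x - h)\<^sup>2 / (2 * \<sigma>\<^sup>2) = (- x\<^sup>2 + (2 * (x * h) + - h\<^sup>2)) / (2 * \<sigma>\<^sup>2)"
    by (simp add: power2_diff)
  also have "\<dots> = - x\<^sup>2 / (2 * \<sigma>\<^sup>2) + (x / \<sigma>\<^sup>2 * h + - 1 / (2 * \<sigma>\<^sup>2) * h\<^sup>2)"
    unfolding add_divide_distrib by simp
  finally show ?thesis
    unfolding normal_density_def diff_zero mult.assoc exp_add[symmetric] by (rule arg_cong)
qed

text \<open>
  The exponential is the majorant of the Taylor series of \<open>normal_density_diff\<close>, with \<open>\<bar>h\<bar> \<le> r\<close>.
\<close>

lemma normal_density_mult_exp_le:
  "normal_density 0 \<sigma> x * exp (\<bar>x / \<sigma>\<^sup>2\<bar> * r + \<bar>- 1 / (2 * \<sigma>\<^sup>2)\<bar> * r\<^sup>2)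
    \<le> sqrt 2 * exp (3 * r\<^sup>2 / (2 * \<sigma>\<^sup>2)) * normal_density 0 (sqrt 2 * \<sigma>) x"
proof -
  \<comment> \<open>The weight 1/2 lets the cross term consume just half of the Gaussian exponent;
    the other half is that of standard deviation \<open>sqrt 2 * \<sigma>\<close>. The remaining
    \<open>r\<^sup>2\<close> terms add up to the factor 3/2, and \<open>sqrt 2\<close> is the ratio
    of the normalizing constants.\<close>
  have "0 \<le> (\<bar>x\<bar> / 2 - r)\<^sup>2" by simp
  then have "\<bar>x\<bar> * r \<le> x\<^sup>2 / 4 + r\<^sup>2" by (simp add: power2_diff power_divide)
  define y where "y = 1 / \<sigma>\<^sup>2"
  have "\<bar>x\<bar> * r * y \<le> (x\<^sup>2 / 4 + r\<^sup>2) * y"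
    using \<open>\<bar>x\<bar> * r \<le> _\<close> by (rule mult_right_mono) (simp add: y_def)
  then have le: "\<bar>x\<bar> * r * y \<le> x\<^sup>2 * y / 4 + r\<^sup>2 * y"
    by (simp add: distrib_right)
  have eq: "- x\<^sup>2 / (2 * \<sigma>\<^sup>2) = - (x\<^sup>2 * y / 2)" "\<bar>x / \<sigma>\<^sup>2\<bar> * r = \<bar>x\<bar> * r * y"
    "\<bar>- 1 / (2 * \<sigma>\<^sup>2)\<bar> * r\<^sup>2 = r\<^sup>2 * y / 2" "3 * r\<^sup>2 / (2 * \<sigma>\<^sup>2) = 3 * (r\<^sup>2 * y) / 2"
    "- x\<^sup>2 / (2 * (sqrt 2 * \<sigma>)\<^sup>2) = - (x\<^sup>2 * y / 4)"
    by (simp_all add: y_def power_mult_distrib)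
  have "- x\<^sup>2 / (2 * \<sigma>\<^sup>2) + (\<bar>x / \<sigma>\<^sup>2\<bar> * r + \<bar>- 1 / (2 * \<sigma>\<^sup>2)\<bar> * r\<^sup>2)
      \<le> 3 * r\<^sup>2 / (2 * \<sigma>\<^sup>2) + - x\<^sup>2 / (2 * (sqrt 2 * \<sigma>)\<^sup>2)"
    unfolding eq using le by linarith
  then have "exp (- x\<^sup>2 / (2 * \<sigma>\<^sup>2)) * exp (\<bar>x / \<sigma>\<^sup>2\<bar> * r + \<bar>- 1 / (2 * \<sigma>\<^sup>2)\<bar> * r\<^sup>2)
      \<le> exp (3 * r\<^sup>2 / (2 * \<sigma>\<^sup>2)) * exp (- x\<^sup>2 / (2 * (sqrt 2 * \<sigma>)\<^sup>2))"
    unfolding exp_add[symmetric] exp_le_cancel_iff .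
  then have "1 / sqrt (2 * pi * \<sigma>\<^sup>2) * (exp (- x\<^sup>2 / (2 * \<sigma>\<^sup>2)) *
        exp (\<bar>x / \<sigma>\<^sup>2\<bar> * r + \<bar>- 1 / (2 * \<sigma>\<^sup>2)\<bar> * r\<^sup>2))
      \<le> 1 / sqrt (2 * pi * \<sigma>\<^sup>2) * (exp (3 * r\<^sup>2 / (2 * \<sigma>\<^sup>2)) * exp (- x\<^sup>2 / (2 * (sqrt 2 * \<sigma>)\<^sup>2)))"
    by (rule mult_left_mono) simp
  moreover have "sqrt (2 * pi * (sqrt 2 * \<sigma>)\<^sup>2) = sqrt 2 * sqrt (2 * pi * \<sigma>\<^sup>2)"
  proof -
    have "2 * pi * (sqrt 2 * \<sigma>)\<^sup>2 = 2 * (2 * pi * \<sigma>\<^sup>2)"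
      by (simp add: power_mult_distrib)
    then show ?thesis by (simp only: real_sqrt_mult[of 2])
  qed
  ultimately show ?thesis
    unfolding normal_density_def by (simp add: mult.assoc)
qed

section \<open>Integration against the Gaussian and the expansion of the smoothed classifier\<close>

lemma integrable_gaussian_density:
  assumes "\<sigma> > 0"
  shows "integrable lborel (gaussian_density \<sigma> :: real ^ 'd::finite \<Rightarrow> real)"
proof (rule integrableI_nonneg)
  show "gaussian_density \<sigma> \<in> borel_measurable (lborel :: (real ^ 'd) measure)"
    unfolding gaussian_density_def[abs_def] by measurable
  show "AE x in lborel. 0 \<le> gaussian_density \<sigma> (x :: real ^ 'd)"
    by (simp add: gaussian_density_def)
  \<comment> \<open>Translates between products over coordinates and products over
    \<open>Basis\<close>, the form in which Tonelli's theorem for \<open>lborel\<close> is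
    stated.\<close>
  have B: "(\<Prod>b\<in>Basis. f (x \<bullet> b)) = (\<Prod>i\<in>UNIV. f (x $ i))" for f :: "real \<Rightarrow> real" and x :: "real ^ 'd"
    by (rule prod.reindex_cong[of "\<lambda>i. axis i 1" UNIV])
      (auto simp: Basis_vec_def inj_on_def axis_eq_axis inner_axis)
  have "(\<integral>\<^sup>+x. ennreal (gaussian_density \<sigma> (x :: real ^ 'd)) \<partial>lborel) =
      (\<integral>\<^sup>+x. (\<Prod>b\<in>Basis. ennreal (normal_density 0 \<sigma> ((x :: real ^ 'd) \<bullet> b))) \<partial>lborel)"
    by (simp add: gaussian_density_eq_prod B prod_ennreal)
  also have "\<dots> = (\<Prod>b\<in>(Basis :: (real ^ 'd) set). \<integral>\<^sup>+x. ennreal (normal_density 0 \<sigma> x) \<partial>lborel)"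
    by (rule nn_integral_lborel_prod) auto
  also have "\<dots> < \<infinity>"
    using assms by (simp add: nn_integral_eq_integral)
  finally show "(\<integral>\<^sup>+x. ennreal (gaussian_density \<sigma> (x :: real ^ 'd)) \<partial>lborel) < \<infinity>" .
qed

text \<open>Translation invariance moves \<open>h\<close> from \<open>f\<close>, which is merely
  measurable, into the density, where it can be expanded.\<close>

lemma smoothed_eq:
  fixes f :: "real ^ 'd::finite \<Rightarrow> real ^ 'y::finite"
  assumes [measurable]: "f \<in> borel_measurable borel" "\<mu> \<in> borel_measurable borel"
  shows "smoothed f \<mu> (w + h) = (\<integral>u. \<mu> (u - h) *\<^sub>R f (w + u) \<partial>lborel)"
proof -
  have "(\<integral>u. \<mu> (u - h) *\<^sub>R f (w + u) \<partial>lborel) =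
      (\<integral>u. \<mu> (u - h) *\<^sub>R f (w + u) \<partial>distr lborel borel ((+) h))"
    by (simp add: lborel_distr_plus)
  also have "\<dots> = smoothed f \<mu> (w + h)"
    by (subst integral_distr) (simp_all add: smoothed_def add.assoc)
  finally show ?thesis by simp
qed

lemma prob_simplex_norm_le: "p \<in> prob_simplex \<Longrightarrow> norm p \<le> 1"
  using norm_le_l1_cart[of p] by (simp add: prob_simplex_def)

lemma smoothed_gaussian_multi_series:
  fixes f :: "real ^ 'd::finite \<Rightarrow> real ^ 'y::finite"
  assumes \<sigma>: "\<sigma> > 0" and f: "f \<in> classifiers"
  shows "\<exists>a. entire_coeffs a \<and> (\<forall>h. smoothed f (gaussian_density \<sigma>) (w + h) = multi_series a h)"
proof -
  define c where "c = - 1 / (2 * \<sigma>\<^sup>2)"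
  \<comment> \<open>The coefficient of \<open>multi_power h \<alpha>\<close> in the quotient of the
    translated Gaussian at \<open>u\<close> by the original one.\<close>
  define Q where "Q \<alpha> u = (\<Prod>i\<in>UNIV. gauss_coeff (u $ i / \<sigma>\<^sup>2) c (\<alpha> i))"
    for \<alpha> :: "'d \<Rightarrow> nat" and u :: "real ^ 'd"
  define F where "F \<alpha> u = (gaussian_density \<sigma> u * Q \<alpha> u) *\<^sub>R f (w + u)" for \<alpha> u
  define G where "G r u = (sqrt 2 * exp (3 * r\<^sup>2 / (2 * \<sigma>\<^sup>2))) ^ CARD('d) * gaussian_density (sqrt 2 * \<sigma>) u"
    for r and u :: "real ^ 'd"
  define a where "a \<alpha> = (\<integral>u. F \<alpha> u \<partial>lborel)" for \<alpha>
  have [measurable]: "f \<in> borel_measurable borel" and f1: "norm (f x) \<le> 1" for x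
    using f prob_simplex_norm_le by (auto simp: classifiers_def)
  have [measurable]: "gaussian_density \<sigma> \<in> borel_measurable (borel :: (real ^ 'd) measure)"
    unfolding gaussian_density_def[abs_def] by measurable
  have gd0: "0 \<le> gaussian_density \<sigma> u" for u :: "real ^ 'd"
    by (simp add: gaussian_density_def)
  have meas: "F \<alpha> \<in> borel_measurable lborel" for \<alpha>
    unfolding F_def[abs_def] Q_def gauss_coeff_def by measurable
  have intG: "integrable lborel (G r)" for r
    unfolding G_def[abs_def] using \<sigma> by (intro integrable_mult_right integrable_gaussian_density) simp
  \<comment> \<open>Used at three radii: 1 for integrability of each \<open>F \<alpha>\<close>,
    arbitrary \<open>r\<close> for \<open>entire_coeffs a\<close>, and \<open>norm h\<close> for
    termwise integration.\<close>
  have bound: "(\<Sum>\<alpha>\<in>A. r ^ sum \<alpha> UNIV * norm (F \<alpha> u)) \<le> G r u" if "finite A" "r \<ge> 0" for A r u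
  proof -
    have "(\<Sum>\<alpha>\<in>A. r ^ sum \<alpha> UNIV * norm (F \<alpha> u))
        \<le> (\<Sum>\<alpha>\<in>A. gaussian_density \<sigma> u * (r ^ sum \<alpha> UNIV * \<bar>Q \<alpha> u\<bar>))"
    proof (rule sum_mono)
      fix \<alpha>
      have "norm (F \<alpha> u) \<le> gaussian_density \<sigma> u * \<bar>Q \<alpha> u\<bar>"
        unfolding F_def using f1[of "w + u"] gd0[of u] by (simp add: abs_mult mult_left_le)
      from mult_left_mono[OF this, of "r ^ sum \<alpha> UNIV"]
      show "r ^ sum \<alpha> UNIV * norm (F \<alpha> u) \<le> gaussian_density \<sigma> u * (r ^ sum \<alpha> UNIV * \<bar>Q \<alpha> u\<bar>)"
        using that by (simp add: mult.left_commute)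
    qed
    also have "\<dots> \<le> gaussian_density \<sigma> u * (\<Prod>i\<in>UNIV. exp (\<bar>u $ i / \<sigma>\<^sup>2\<bar> * r + \<bar>c\<bar> * r\<^sup>2))"
      unfolding sum_distrib_left[symmetric] Q_def
      using that gd0 by (intro mult_left_mono sum_prod_gauss_coeff_le)
    also have "\<dots> = (\<Prod>i\<in>UNIV. normal_density 0 \<sigma> (u $ i) * exp (\<bar>u $ i / \<sigma>\<^sup>2\<bar> * r + \<bar>c\<bar> * r\<^sup>2))"
      unfolding gaussian_density_eq_prod prod.distrib[symmetric] by (simp add: divide_inverse mult.commute)
    also have "\<dots> \<le> (\<Prod>i\<in>UNIV. sqrt 2 * exp (3 * r\<^sup>2 / (2 * \<sigma>\<^sup>2)) * normal_density 0 (sqrt 2 * \<sigma>) (u $ i))"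
      unfolding c_def using \<sigma> by (intro prod_mono conjI normal_density_mult_exp_le) auto
    also have "\<dots> = G r u"
      unfolding G_def gaussian_density_eq_prod by (simp only: prod.distrib prod_constant power_mult_distrib)
    finally show ?thesis .
  qed
  have int: "integrable lborel (F \<alpha>)" for \<alpha>
  proof (rule Bochner_Integration.integrable_bound[OF intG[of 1] meas])
    show "AE u in lborel. norm (F \<alpha> u) \<le> norm (G 1 u)"
      using bound[of "{\<alpha>}" 1] by (intro AE_I2) (auto intro: order_trans[OF _ abs_ge_self])
  qed
  have "entire_coeffs a"
    unfolding entire_coeffs_def
  proof (intro allI impI)
    fix r :: real assume r: "r \<ge> 0"
    have "(\<Sum>\<alpha>\<in>A. r ^ sum \<alpha> UNIV * norm (a \<alpha>)) \<le> (\<integral>u. G r u \<partial>lborel)" if "finite A" for A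
    proof -
      have "(\<Sum>\<alpha>\<in>A. r ^ sum \<alpha> UNIV * norm (a \<alpha>)) \<le> (\<Sum>\<alpha>\<in>A. r ^ sum \<alpha> UNIV * (\<integral>u. norm (F \<alpha> u) \<partial>lborel))"
        unfolding a_def using r by (intro sum_mono mult_left_mono integral_norm_bound) auto
      also have "\<dots> = (\<integral>u. (\<Sum>\<alpha>\<in>A. r ^ sum \<alpha> UNIV * norm (F \<alpha> u)) \<partial>lborel)"
        using int by (subst Bochner_Integration.integral_sum) auto
      also have "\<dots> \<le> (\<integral>u. G r u \<partial>lborel)"
        using int intG bound[OF that r] by (intro integral_mono Bochner_Integration.integrable_sum) auto
      finally show ?thesis .
    qed
    then show "(\<lambda>\<alpha>. r ^ sum \<alpha> UNIV * norm (a \<alpha>)) summable_on UNIV"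
      using r by (intro nonneg_bdd_above_summable_on bdd_aboveI) auto
  qed
  moreover have "smoothed f (gaussian_density \<sigma>) (w + h) = multi_series a h" for h
  proof -
    have "((\<lambda>\<alpha>. \<integral>u. multi_power h \<alpha> *\<^sub>R F \<alpha> u \<partial>lborel) has_sum
        (\<integral>u. gaussian_density \<sigma> (u - h) *\<^sub>R f (w + u) \<partial>lborel)) UNIV"
    proof (rule has_sum_integral[OF _ infinite_UNIV_multi_index _ intG[of "norm h"]])
      show "(\<lambda>u. multi_power h \<alpha> *\<^sub>R F \<alpha> u) \<in> borel_measurable lborel" for \<alpha>
        using meas by measurable
      show "(\<Sum>\<alpha>\<in>A. norm (multi_power h \<alpha> *\<^sub>R F \<alpha> u)) \<le> G (norm h) u" if "finite A" for A u
      proof (rule order_trans[OF _ bound[OF that norm_ge_zero]])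
        show "(\<Sum>\<alpha>\<in>A. norm (multi_power h \<alpha> *\<^sub>R F \<alpha> u)) \<le> (\<Sum>\<alpha>\<in>A. norm h ^ sum \<alpha> UNIV * norm (F \<alpha> u))"
          by (auto intro!: sum_mono mult_right_mono abs_multi_power_le_norm)
      qed
      show "((\<lambda>\<alpha>. multi_power h \<alpha> *\<^sub>R F \<alpha> u) has_sum gaussian_density \<sigma> (u - h) *\<^sub>R f (w + u)) UNIV" for u
      proof -
        have "gaussian_density \<sigma> (u - h) =
            gaussian_density \<sigma> u * (\<Prod>i\<in>UNIV. exp (u $ i / \<sigma>\<^sup>2 * h $ i + c * (h $ i)\<^sup>2))"
          unfolding gaussian_density_eq_prod prod.distrib[symmetric] c_def
          by (simp only: normal_density_diff vector_minus_component)
        moreover have "((\<lambda>\<alpha>. (gaussian_density \<sigma> u * (multi_power h \<alpha> * Q \<alpha> u)) *\<^sub>R f (w + u)) has_sum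
            (gaussian_density \<sigma> u * (\<Prod>i\<in>UNIV. exp (u $ i / \<sigma>\<^sup>2 * h $ i + c * (h $ i)\<^sup>2))) *\<^sub>R f (w + u)) UNIV"
          unfolding Q_def
          by (intro has_sum_bounded_linear[OF bounded_linear_scaleR_left] has_sum_cmult_right prod_gauss_coeff_has_sum)
        ultimately show ?thesis
          by (simp add: F_def mult.left_commute)
      qed
    qed simp
    then show ?thesis
      by (simp add: smoothed_eq multi_series_def a_def infsumI)
  qed
  ultimately show ?thesis by blast
qed

theorem theorem2:
  fixes \<sigma> :: real
    and g :: "real ^ 'd::finite \<Rightarrow> real ^ 'y::finite"
  assumes "\<sigma> > 0"
    and "g \<in> smoothed_class classifiers (gaussian_density \<sigma>)"
  shows "real_analytic_infinite_radius g"
proof -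
  obtain f where "f \<in> classifiers" and g: "g = smoothed f (gaussian_density \<sigma>)"
    using assms(2) by (auto simp: smoothed_class_def)
  then show ?thesis
    unfolding g using assms(1)
    by (intro real_analytic_infinite_radiusI smoothed_gaussian_multi_series)
qed

end
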